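(* Every $3$-edge-connected $3$-edge-colorable graph $G$ satisfies $f(G)\leq 3$.
   Context: Graphs are finite and undirected; parallel edges are allowed. For a graph $G=(V,E)$ and $X\subseteq V$, $\delta_G(X)$ is the set of edges with exactly one endvertex in $X$, and $G$ is $k$-edge-connected if $|\delta_G(X)|\ge k$ for every nonempty proper subset $X$ of $V$. $G$ is $3$-edge-colorable if $E$ can be partitioned into $3$ matchings. An orientation of $G$ replaces each edge $uv$ by exactly one of the arcs $uv$ or $vu$; for $e\in E$, $\vec e$ denotes the corresponding arc. A digraph is strongly connected if for every nonempty proper vertex subset $X$ some arc leaves $X$. For a $3$-edge-connected graph $G$, the Frank number $f(G)$ is the minimum integer $k$ such that there exist $k$ orientations $D_1,\dots,D_k$ of $G$ with the property that for every edge $e$ of $G$ there is an $i$ with $D_i-\vec e$ strongly connected. *)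

theory Defs
  imports "Graph_Theory.Digraph_Component" "HOL-Library.Extended_Nat"
begin

section \<open>Undirected graphs with parallel edges\<close>

record ('v, 'e) ugraph =
  vertices :: "'v set"
  edges :: "'e set"
  ends :: "'e \<Rightarrow> 'v set"

text \<open>Edges are abstract objects carrying a two-element set of endvertices, so parallel edges
  are distinct elements with the same image under \<^const>\<open>ends\<close>; there are no loops.\<close>

definition finite_multigraph :: "('v, 'e) ugraph \<Rightarrow> bool" where
  "finite_multigraph G \<longleftrightarrow> finite (vertices G) \<and> finite (edges G) \<and>
     (\<forall>e \<in> edges G. ends G e \<subseteq> vertices G \<and> card (ends G e) = 2)"

definition edge_cut :: "('v, 'e) ugraph \<Rightarrow> 'v set \<Rightarrow> 'e set" where
  "edge_cut G X = {e \<in> edges G. card (ends G e \<inter> X) = 1}"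

definition k_edge_connected :: "nat \<Rightarrow> ('v, 'e) ugraph \<Rightarrow> bool" where
  "k_edge_connected k G \<longleftrightarrow>
     (\<forall>X. X \<noteq> {} \<and> X \<subset> vertices G \<longrightarrow> k \<le> card (edge_cut G X))"

definition is_matching :: "('v, 'e) ugraph \<Rightarrow> 'e set \<Rightarrow> bool" where
  "is_matching G M \<longleftrightarrow> M \<subseteq> edges G \<and>
     (\<forall>e \<in> M. \<forall>f \<in> M. e \<noteq> f \<longrightarrow> ends G e \<inter> ends G f = {})"

text \<open>The classes of the partition may be empty, as usual for colorings.\<close>

definition k_edge_colorable :: "nat \<Rightarrow> ('v, 'e) ugraph \<Rightarrow> bool" where
  "k_edge_colorable k G \<longleftrightarrow>
     (\<exists>M :: nat \<Rightarrow> 'e set. (\<forall>i < k. is_matching G (M i)) \<and> (\<Union>i<k. M i) = edges G \<and>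
        (\<forall>i < k. \<forall>j < k. i \<noteq> j \<longrightarrow> M i \<inter> M j = {}))"

section \<open>Orientations and the Frank number\<close>

text \<open>The arc of an orientation that replaces the edge \<open>e\<close> is named \<open>e\<close> as well.\<close>

definition is_orientation :: "('v, 'e) ugraph \<Rightarrow> ('v, 'e) pre_digraph \<Rightarrow> bool" where
  "is_orientation G D \<longleftrightarrow> verts D = vertices G \<and> arcs D = edges G \<and>
     (\<forall>e \<in> edges G. {tail D e, head D e} = ends G e)"

definition strong_digraph :: "('v, 'e) pre_digraph \<Rightarrow> bool" where
  "strong_digraph D \<longleftrightarrow>
     (\<forall>X. X \<noteq> {} \<and> X \<subset> verts D \<longrightarrow> (\<exists>a \<in> arcs D. tail D a \<in> X \<and> head D a \<notin> X))"

text \<open>Apart from the null graph, this agrees with the reachability-based notion of the library.\<close>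

lemma strong_digraph_iff_strongly_connected:
  assumes "wf_digraph D" and ne: "verts D \<noteq> {}"
  shows "strong_digraph D \<longleftrightarrow> strongly_connected D"
proof
  interpret wf_digraph D by fact
  assume S: "strong_digraph D"
  show "strongly_connected D"
    unfolding strongly_connected_def
  proof (intro conjI ballI ne)
    fix u v assume u: "u \<in> verts D" and v: "v \<in> verts D"
    show "u \<rightarrow>\<^sup>*\<^bsub>D\<^esub> v"
    proof (rule ccontr)
      assume nr: "\<not> u \<rightarrow>\<^sup>*\<^bsub>D\<^esub> v"
      define X where "X = {w \<in> verts D. u \<rightarrow>\<^sup>*\<^bsub>D\<^esub> w}"
      have "u \<in> X" using u unfolding X_def by simp
      moreover have "X \<subset> verts D" using nr v unfolding X_def by auto
      ultimately have "X \<noteq> {} \<and> X \<subset> verts D" by auto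
      then have "\<exists>a \<in> arcs D. tail D a \<in> X \<and> head D a \<notin> X"
        using S unfolding strong_digraph_def by (elim allE impE)
      then obtain a where a: "a \<in> arcs D" "tail D a \<in> X" "head D a \<notin> X"
        by (elim bexE conjE)
      have "u \<rightarrow>\<^sup>*\<^bsub>D\<^esub> tail D a" using a(2) unfolding X_def by simp
      moreover have "tail D a \<rightarrow>\<^bsub>D\<^esub> head D a"
        using a(1) by (simp add: arcs_ends_def arc_to_ends_def)
      ultimately have "u \<rightarrow>\<^sup>*\<^bsub>D\<^esub> head D a" by (rule reachable_adj_trans)
      then show False using a(1,3) unfolding X_def by simp
    qed
  qed
next
  interpret wf_digraph D by fact
  assume C: "strongly_connected D"
  show "strong_digraph D"
    unfolding strong_digraph_def
  proof (intro allI impI, rule ccontr)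
    fix X assume X: "X \<noteq> {} \<and> X \<subset> verts D"
      and no: "\<not> (\<exists>a \<in> arcs D. tail D a \<in> X \<and> head D a \<notin> X)"
    from X obtain u v where u: "u \<in> X" and v: "v \<in> verts D" "v \<notin> X" by blast
    have "u \<rightarrow>\<^sup>*\<^bsub>D\<^esub> v" using C X u v unfolding strongly_connected_def by blast
    then have "v \<in> X"
    proof (induct rule: reachable_induct)
      case base then show ?case using u by simp
    next
      case (step x y)
      then show ?case using no by (auto simp: arcs_ends_def arc_to_ends_def)
    qed
    with v show False by simp
  qed
qed

definition frank_orientations :: "('v, 'e) ugraph \<Rightarrow> nat \<Rightarrow> (nat \<Rightarrow> ('v, 'e) pre_digraph) \<Rightarrow> bool" where
  "frank_orientations G k D \<longleftrightarrow>
     (\<forall>i \<in> {1..k}. is_orientation G (D i)) \<and>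
     (\<forall>e \<in> edges G. \<exists>i \<in> {1..k}. strong_digraph (pre_digraph.del_arc (D i) e))"

text \<open>The minimum is taken in \<^typ>\<open>enat\<close> so that it is \<open>\<infinity>\<close>, rather than an unspecified number,
  if no such family of orientations exists.\<close>

definition frank_number :: "('v, 'e) ugraph \<Rightarrow> enat" where
  "frank_number G = Inf {enat k | k. \<exists>D. frank_orientations G k D}"

lemma frank_number_eq_Least:
  assumes "\<exists>k D. frank_orientations G k D"
  shows "frank_number G = enat (LEAST k. \<exists>D. frank_orientations G k D)"
  unfolding frank_number_def
proof (rule antisym)
  show "Inf {enat k | k. \<exists>D. frank_orientations G k D} \<le>
      enat (LEAST k. \<exists>D. frank_orientations G k D)"
    using LeastI_ex[OF assms] by (intro Inf_lower) blast
  show "enat (LEAST k. \<exists>D. frank_orientations G k D) \<le>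
      Inf {enat k | k. \<exists>D. frank_orientations G k D}"
  proof (rule Inf_greatest)
    fix x assume "x \<in> {enat k | k. \<exists>D. frank_orientations G k D}"
    then obtain k where "x = enat k" and "\<exists>D. frank_orientations G k D" by blast
    then show "enat (LEAST k. \<exists>D. frank_orientations G k D) \<le> x"
      using Least_le[of "\<lambda>k. \<exists>D. frank_orientations G k D" k] by simp
  qed
qed

end

theory Submission
  imports Defs
begin

text \<open>A graph as in the theorem with at least one edge is cubic, and each colour class \<open>M\<close> is a
  perfect matching. It suffices to orient \<open>G\<close> so that every edge of \<open>M\<close> can be deleted. The
  other two classes form a 2-factor \<open>F\<close>, which we orient with in-degree equal to out-degree.
  Contracting the components of \<open>F\<close> leaves a graph with edge set \<open>M\<close> in which all degrees are
  even, because the cycles of \<open>F\<close> alternate between two matchings; so \<open>M\<close> has an orientation that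
  is balanced on every union \<open>X\<close> of components of \<open>F\<close>. For such \<open>X\<close> the cut lies in \<open>M\<close>, has at
  least three edges and is balanced, so two arcs leave \<open>X\<close>. Every other cut is
  crossed by \<open>F\<close>, hence left by an arc of \<open>F\<close>.\<close>

section \<open>Balanced orientations of Eulerian graphs\<close>

text \<open>\<open>t\<close> and \<open>h\<close> give tail and head. The net out-degree is an
  integer sum over edges, so a loop contributes zero and the vertices may later be classes of a
  contraction.\<close>

definition balanced :: "'e set \<Rightarrow> ('e \<Rightarrow> 'v) \<Rightarrow> ('e \<Rightarrow> 'v) \<Rightarrow> bool" where
  "balanced E t h \<longleftrightarrow>
     (\<forall>v. (\<Sum>e\<in>E. of_bool (t e = v) - of_bool (h e = v) :: int) = 0)"

text \<open>Sum the condition over \<open>v \<in> X\<close>: an arc with both ends in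
  \<open>X\<close> cancels, so equally many arcs leave and enter \<open>X\<close>.\<close>

lemma balanced_cut:
  fixes t h :: "'e \<Rightarrow> 'v"
  assumes "balanced E t h" and "finite X"
  shows "(\<Sum>e\<in>E. of_bool (t e \<in> X) - of_bool (h e \<in> X) :: int) = 0"
proof -
  have "(of_bool (u \<in> X) :: int) = (\<Sum>v\<in>X. of_bool (u = v))" for u :: 'v
    using \<open>finite X\<close> by (simp add: of_bool_def)
  then have "(\<Sum>e\<in>E. of_bool (t e \<in> X) - of_bool (h e \<in> X) :: int) =
      (\<Sum>e\<in>E. \<Sum>v\<in>X. of_bool (t e = v) - of_bool (h e = v))"
    by (simp only: sum_subtractf)
  also have "\<dots> = (\<Sum>v\<in>X. \<Sum>e\<in>E. of_bool (t e = v) - of_bool (h e = v))"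
    by (rule sum.swap)
  also have "\<dots> = 0"
    using assms(1) unfolding balanced_def by simp
  finally show ?thesis .
qed

text \<open>Induction on the number of edges: delete a loop, or merge two edges at a common vertex
  into one and route the orientation of the merged edge through that vertex. Only end functions
  occur, so merging just changes their values; \<open>s e\<close> says whether \<open>a e\<close> is
  the tail.\<close>

lemma eulerian_orientation:
  fixes a b :: "'e \<Rightarrow> 'v"
  assumes "finite E"
    and "\<And>v. even (\<Sum>e\<in>E. of_bool (a e = v) + of_bool (b e = v) :: int)"
  shows "\<exists>s. balanced E (\<lambda>e. if s e then a e else b e) (\<lambda>e. if s e then b e else a e)"
  using assms
proof (induction "card E" arbitrary: E a b rule: less_induct)
  case less
  show ?case
  proof (cases "E = {}")
    case True
    then show ?thesis by (simp add: balanced_def)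
  next
    case False
    then obtain e where e: "e \<in> E" by blast
    define E' where "E' = E - {e}"
    have fin': "finite E'" and card': "card E' < card E"
      using e less.prems(1) unfolding E'_def by (simp, metis card_Diff1_less)
    have split: "(\<Sum>x\<in>E. f x) = f e + (\<Sum>x\<in>E'. f x)" for f :: "'e \<Rightarrow> int"
      unfolding E'_def by (rule sum.remove[OF less.prems(1) e])
    show ?thesis
    proof (cases "a e = b e")
      case True
      \<comment> \<open>A loop adds two to a degree, so its removal keeps parities, and either
        direction of it is balanced.\<close>
      have "even (\<Sum>x\<in>E'. of_bool (a x = v) + of_bool (b x = v) :: int)" for v
        using less.prems(2)[of v] True unfolding split by auto
      from less.hyps[OF card' fin' this] obtain s where
        "balanced E' (\<lambda>x. if s x then a x else b x) (\<lambda>x. if s x then b x else a x)" by blast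
      then have "balanced E (\<lambda>x. if s x then a x else b x) (\<lambda>x. if s x then b x else a x)"
        unfolding balanced_def split using True by simp
      then show ?thesis by blast
    next
      case False
      \<comment> \<open>The non-loop \<open>e\<close> adds one to the degree of \<open>b e\<close>;
        evenness forces a further edge there.\<close>
      have "\<exists>f\<in>E'. a f = b e \<or> b f = b e"
      proof (rule ccontr)
        assume "\<not> ?thesis"
        then have "(\<Sum>x\<in>E'. of_bool (a x = b e) + of_bool (b x = b e) :: int) = 0"
          by (intro sum.neutral) auto
        with less.prems(2)[of "b e"] False show False unfolding split by simp
      qed
      then obtain f where f: "f \<in> E'" "a f = b e \<or> b f = b e" by blast
      \<comment> \<open>\<open>w\<close> is the far end of \<open>f\<close>, seen from
        \<open>b e\<close>.\<close>
      define w where "w = (if a f = b e then b f else a f)"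
      define E'' where "E'' = E' - {f}"
      have split': "(\<Sum>x\<in>E'. g x) = g f + (\<Sum>x\<in>E''. g x)" for g :: "'e \<Rightarrow> int"
        unfolding E''_def by (rule sum.remove[OF fin' f(1)])
      have ef: "e \<noteq> f" "e \<notin> E''" "f \<notin> E''"
        using f(1) unfolding E''_def E'_def by auto
      \<comment> \<open>Splitting off: the path formed by \<open>e\<close> and \<open>f\<close> is replaced by a single edge named \<open>f\<close>.\<close>
      define a' where "a' = a(f := a e)"
      define b' where "b' = b(f := w)"
      have cong'': "(\<Sum>x\<in>E''. g (a' x) (b' x) x) = (\<Sum>x\<in>E''. g (a x) (b x) x)"
        for g :: "'v \<Rightarrow> 'v \<Rightarrow> 'e \<Rightarrow> int"
        using ef by (intro sum.cong) (auto simp: a'_def b'_def)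
      have ends_f: "of_bool (a f = v) + of_bool (b f = v) =
          (of_bool (b e = v) + of_bool (w = v) :: int)" for v
        using f(2) unfolding w_def by auto
      \<comment> \<open>Splitting off lowers the degree of \<open>b e\<close> by two and keeps all
        others.\<close>
      have "even (\<Sum>x\<in>E'. of_bool (a' x = v) + of_bool (b' x = v) :: int)" for v
      proof -
        have "(\<Sum>x\<in>E. of_bool (a x = v) + of_bool (b x = v) :: int) =
            2 * of_bool (b e = v) + (\<Sum>x\<in>E'. of_bool (a' x = v) + of_bool (b' x = v))"
          unfolding split split' cong''[of "\<lambda>p q _. of_bool (p = v) + of_bool (q = v)"] ends_f
          by (simp add: a'_def b'_def)
        with less.prems(2)[of v] show ?thesis by simp
      qed
      from less.hyps[OF card' fin' this] obtain s where
        s: "balanced E' (\<lambda>x. if s x then a' x else b' x) (\<lambda>x. if s x then b' x else a' x)" by blast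
      \<comment> \<open>The merged edge runs from \<open>a e\<close> to \<open>w\<close> when
        \<open>s f\<close> holds. Then \<open>e\<close> leads into \<open>b e\<close> and
        \<open>f\<close> out of it, which is the direction from \<open>a f\<close> to
        \<open>b f\<close> just when \<open>a f = b e\<close>; otherwise both are reversed.\<close>
      define r where "r = s(e := s f, f := (s f \<longleftrightarrow> a f = b e))"
      have "(\<Sum>x\<in>E. of_bool ((if r x then a x else b x) = v) -
                   of_bool ((if r x then b x else a x) = v) :: int) = 0" for v
      proof -
        have "(\<Sum>x\<in>E''. of_bool ((if r x then a x else b x) = v) -
                   of_bool ((if r x then b x else a x) = v) :: int) =
              (\<Sum>x\<in>E''. of_bool ((if s x then a x else b x) = v) -
                   of_bool ((if s x then b x else a x) = v))"
          using ef by (intro sum.cong) (auto simp: r_def)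
        moreover have "of_bool ((if r e then a e else b e) = v) -
                   of_bool ((if r e then b e else a e) = v) +
              (of_bool ((if r f then a f else b f) = v) -
                   of_bool ((if r f then b f else a f) = v)) =
              (of_bool ((if s f then a e else w) = v) -
                   of_bool ((if s f then w else a e) = v) :: int)"
          using ef(1) f(2) by (cases "s f"; cases "a f = b e") (simp_all add: r_def w_def)
        moreover have "(\<Sum>x\<in>E'. of_bool ((if s x then a' x else b' x) = v) -
                   of_bool ((if s x then b' x else a' x) = v) :: int) = 0"
          using s unfolding balanced_def by blast
        then have "of_bool ((if s f then a e else w) = v) -
                   of_bool ((if s f then w else a e) = v) +
              (\<Sum>x\<in>E''. of_bool ((if s x then a x else b x) = v) -
                   of_bool ((if s x then b x else a x) = v)) = (0 :: int)"
          unfolding split' cong''[of "\<lambda>p q x. of_bool ((if s x then p else q) = v) -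
                   of_bool ((if s x then q else p) = v)"]
          by (simp only: a'_def b'_def fun_upd_same)
        ultimately show ?thesis unfolding split split' by linarith
      qed
      then show ?thesis unfolding balanced_def by blast
    qed
  qed
qed

section \<open>Perfect matchings and orientations built from them\<close>

text \<open>Degree one, written as in \<open>eulerian_orientation\<close>, so that matchings enter
  only through degree sums.\<close>

definition perfect_on :: "'v set \<Rightarrow> ('e \<Rightarrow> 'v) \<Rightarrow> ('e \<Rightarrow> 'v) \<Rightarrow> 'e set \<Rightarrow> bool" where
  "perfect_on V a b M \<longleftrightarrow>
     (\<forall>v\<in>V. (\<Sum>e\<in>M. of_bool (a e = v) + of_bool (b e = v) :: int) = 1)"

text \<open>Double counting of ends in \<open>Y\<close>. Hence any two perfect matchings have
  equally many ends in \<open>Y\<close>.\<close>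

lemma perfect_on_sum:
  fixes a b :: "'e \<Rightarrow> 'v"
  assumes "perfect_on V a b M" and "finite Y" and "Y \<subseteq> V"
  shows "(\<Sum>e\<in>M. of_bool (a e \<in> Y) + of_bool (b e \<in> Y) :: int) = int (card Y)"
proof -
  have "(of_bool (u \<in> Y) :: int) = (\<Sum>v\<in>Y. of_bool (u = v))" for u :: 'v
    using \<open>finite Y\<close> by (simp add: of_bool_def)
  then have "(\<Sum>e\<in>M. of_bool (a e \<in> Y) + of_bool (b e \<in> Y) :: int) =
      (\<Sum>e\<in>M. \<Sum>v\<in>Y. of_bool (a e = v) + of_bool (b e = v))"
    by (simp only: sum.distrib)
  also have "\<dots> = (\<Sum>v\<in>Y. \<Sum>e\<in>M. of_bool (a e = v) + of_bool (b e = v))"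
    by (rule sum.swap)
  also have "\<dots> = (\<Sum>v\<in>Y. 1)"
    using assms(1,3) unfolding perfect_on_def by (intro sum.cong) auto
  finally show ?thesis by simp
qed

text \<open>The degree is two on \<open>V\<close> and zero elsewhere, so an Eulerian orientation
  exists.\<close>

lemma two_factor_orientation:
  fixes a b :: "'e \<Rightarrow> 'v"
  assumes fin: "finite V" "finite N" "finite L" and "N \<inter> L = {}"
    and ends: "\<And>e. e \<in> N \<union> L \<Longrightarrow> a e \<in> V \<and> b e \<in> V"
    and perf: "perfect_on V a b N" "perfect_on V a b L"
  shows "\<exists>s. balanced (N \<union> L) (\<lambda>e. if s e then a e else b e) (\<lambda>e. if s e then b e else a e)"
proof (rule eulerian_orientation)
  fix v
  show "even (\<Sum>e\<in>N \<union> L. of_bool (a e = v) + of_bool (b e = v) :: int)"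
  proof (cases "v \<in> V")
    case True
    then show ?thesis
      using perf fin \<open>N \<inter> L = {}\<close> by (simp add: perfect_on_def sum.union_disjoint)
  next
    case False
    then have "(\<Sum>e\<in>N \<union> L. of_bool (a e = v) + of_bool (b e = v) :: int) = 0"
      using ends by (intro sum.neutral) auto
    then show ?thesis by simp
  qed
qed (use fin in simp)

text \<open>When the components of \<open>F\<close> are contracted, a class \<open>Y\<close> has
  degree \<open>card Y\<close> in \<open>M\<close>, which is even because \<open>N\<close> pairs up
  the vertices of \<open>Y\<close>. A set not crossed by \<open>F\<close> is a union of classes, so
  its balance follows from that of the contraction.\<close>

lemma matching_orientation:
  fixes a b :: "'e \<Rightarrow> 'v"
  assumes fin: "finite V" "finite M"
    and ends: "\<And>e. e \<in> M \<union> N \<Longrightarrow> a e \<in> V \<and> b e \<in> V"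
    and perf: "perfect_on V a b M" "perfect_on V a b N"
    and "N \<subseteq> F"
  shows "\<exists>s. \<forall>X\<subseteq>V. (\<forall>e\<in>F. a e \<in> X \<longleftrightarrow> b e \<in> X) \<longrightarrow>
    (\<Sum>e\<in>M. of_bool ((if s e then a e else b e) \<in> X) -
            of_bool ((if s e then b e else a e) \<in> X) :: int) = 0"
proof -
  \<comment> \<open>\<open>c\<close> contracts the components of \<open>F\<close>: it identifies the vertices not separated by any set
    that \<open>F\<close> does not cross.\<close>
  define c where "c v = {X. X \<subseteq> V \<and> (\<forall>e\<in>F. a e \<in> X \<longleftrightarrow> b e \<in> X) \<and> v \<in> X}" for v
  have "\<exists>s. balanced M (\<lambda>e. if s e then (c \<circ> a) e else (c \<circ> b) e)
                   (\<lambda>e. if s e then (c \<circ> b) e else (c \<circ> a) e)"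
  proof (rule eulerian_orientation[OF fin(2)])
    fix C
    \<comment> \<open>The contracted class named \<open>C\<close>; it is empty when no vertex of
      \<open>V\<close> has this name.\<close>
    define Y where "Y = {v \<in> V. c v = C}"
    have Y: "finite Y" "Y \<subseteq> V" unfolding Y_def using fin(1) by auto
    have "(\<Sum>e\<in>M. of_bool ((c \<circ> a) e = C) + of_bool ((c \<circ> b) e = C) :: int) =
        (\<Sum>e\<in>M. of_bool (a e \<in> Y) + of_bool (b e \<in> Y))"
      using ends by (intro sum.cong) (auto simp: Y_def)
    also have "\<dots> = (\<Sum>e\<in>N. of_bool (a e \<in> Y) + of_bool (b e \<in> Y))"
      using perfect_on_sum[OF perf(1) Y] perfect_on_sum[OF perf(2) Y] by simp
    also have "\<dots> = (\<Sum>e\<in>N. 2 * of_bool (a e \<in> Y))"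
    proof (rule sum.cong)
      fix e assume "e \<in> N"
      then have "c (a e) = c (b e)"
        using \<open>N \<subseteq> F\<close> unfolding c_def by blast
      then have "a e \<in> Y \<longleftrightarrow> b e \<in> Y"
        using ends \<open>e \<in> N\<close> unfolding Y_def by simp
      then show "of_bool (a e \<in> Y) + of_bool (b e \<in> Y) = (2 * of_bool (a e \<in> Y) :: int)" by simp
    qed simp
    finally show "even (\<Sum>e\<in>M. of_bool ((c \<circ> a) e = C) + of_bool ((c \<circ> b) e = C) :: int)"
      by (simp add: sum_distrib_left[symmetric])
  qed
  then obtain s where s: "balanced M (\<lambda>e. if s e then (c \<circ> a) e else (c \<circ> b) e)
                   (\<lambda>e. if s e then (c \<circ> b) e else (c \<circ> a) e)" by blast
  show ?thesis
  proof (intro exI allI impI)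
    fix X assume X: "X \<subseteq> V" "\<forall>e\<in>F. a e \<in> X \<longleftrightarrow> b e \<in> X"
    \<comment> \<open>\<open>X\<close> itself belongs to \<open>c u\<close> for each
      \<open>u \<in> X\<close>, so \<open>c v = c u\<close> forces \<open>v \<in> X\<close>.\<close>
    have c: "c v \<in> c ` X \<longleftrightarrow> v \<in> X" for v
      using X unfolding c_def by blast
    have "finite (c ` X)" using X(1) fin(1) finite_subset by blast
    from balanced_cut[OF s this]
    show "(\<Sum>e\<in>M. of_bool ((if s e then a e else b e) \<in> X) -
            of_bool ((if s e then b e else a e) \<in> X) :: int) = 0"
      by (simp add: c if_distrib[of "\<lambda>x. x \<in> c ` X"] if_distrib[of "\<lambda>x. x \<in> X"] cong: if_cong)
  qed
qed

section \<open>One orientation per colour class\<close>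

lemma orientation_deleting_matching:
  fixes G :: "('v, 'e) ugraph" and a b :: "'e \<Rightarrow> 'v"
  assumes fin: "finite (vertices G)" "finite (edges G)"
    and ends: "\<And>e. e \<in> edges G \<Longrightarrow> ends G e = {a e, b e}"
    and verts: "\<And>e. e \<in> edges G \<Longrightarrow> a e \<in> vertices G \<and> b e \<in> vertices G \<and> a e \<noteq> b e"
    and con: "k_edge_connected 3 G"
    and part: "edges G = M \<union> N \<union> L" "M \<inter> N = {}" "M \<inter> L = {}" "N \<inter> L = {}"
    and perf: "perfect_on (vertices G) a b M" "perfect_on (vertices G) a b N"
      "perfect_on (vertices G) a b L"
  shows "\<exists>D. is_orientation G D \<and> (\<forall>e\<in>M. strong_digraph (pre_digraph.del_arc D e))"
proof -
  define F where "F = N \<union> L"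
  have finite: "finite M" "finite N" "finite L" "finite F"
    using fin(2) unfolding part(1) F_def by auto
  obtain p where p: "balanced F (\<lambda>e. if p e then a e else b e) (\<lambda>e. if p e then b e else a e)"
    using two_factor_orientation[OF fin(1) finite(2,3) part(4) _ perf(2,3)] verts
    unfolding part(1) F_def by blast
  obtain q where q: "\<And>X. X \<subseteq> vertices G \<Longrightarrow> \<forall>e\<in>F. a e \<in> X \<longleftrightarrow> b e \<in> X \<Longrightarrow>
    (\<Sum>e\<in>M. of_bool ((if q e then a e else b e) \<in> X) -
            of_bool ((if q e then b e else a e) \<in> X) :: int) = 0"
    using matching_orientation[OF fin(1) finite(1) _ perf(1,2), of F] verts
    unfolding part(1) F_def by blast
  \<comment> \<open>\<open>M\<close> and \<open>F\<close> are disjoint, so \<open>q\<close> and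
    \<open>p\<close> combine without conflict.\<close>
  define s where "s e = (if e \<in> M then q e else p e)" for e
  define t where "t e = (if s e then a e else b e)" for e
  define h where "h e = (if s e then b e else a e)" for e
  define D where "D = \<lparr>pre_digraph.verts = vertices G, arcs = edges G, tail = t, head = h\<rparr>"
  have th: "{t e, h e} = {a e, b e}" for e unfolding t_def h_def by auto
  have "balanced F t h"
  proof -
    have "e \<notin> M" if "e \<in> F" for e using that part(2,3) unfolding F_def by blast
    then show ?thesis
      using p unfolding balanced_def t_def h_def s_def by (simp cong: sum.cong)
  qed
  have strong: "\<exists>x\<in>edges G - {e}. t x \<in> X \<and> h x \<notin> X"
    if "e \<in> M" and X: "X \<noteq> {}" "X \<subset> vertices G" for e X
  proof (cases "\<forall>e\<in>F. a e \<in> X \<longleftrightarrow> b e \<in> X")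
    case False
    then obtain f where "f \<in> F" "(a f \<in> X) \<noteq> (b f \<in> X)" by blast
    then have f: "f \<in> F" "(t f \<in> X) \<noteq> (h f \<in> X)" unfolding t_def h_def by auto
    have "finite X" using X(2) fin(1) by (meson finite_subset psubset_imp_subset)
    \<comment> \<open>If no arc of \<open>F\<close> left \<open>X\<close>, all terms would be at
      most zero and that of \<open>f\<close> negative, against balance.\<close>
    have "\<exists>x\<in>F. t x \<in> X \<and> h x \<notin> X"
    proof (rule ccontr)
      assume no: "\<not> ?thesis"
      have "(\<Sum>x\<in>F. of_bool (t x \<in> X) - of_bool (h x \<in> X) :: int) < (\<Sum>x\<in>F. 0)"
        using no f finite(4) by (intro sum_strict_mono_ex1) auto
      with balanced_cut[OF \<open>balanced F t h\<close> \<open>finite X\<close>] show False by simp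
    qed
    \<comment> \<open>The arc found lies in \<open>F\<close>, so it survives the deletion of
      \<open>e \<in> M\<close>.\<close>
    then show ?thesis using that(1) part unfolding F_def by blast
  next
    case True
    define P where "P = {x \<in> M. t x \<in> X \<and> h x \<notin> X}"
    define Q where "Q = {x \<in> M. t x \<notin> X \<and> h x \<in> X}"
    have "(\<Sum>x\<in>M. of_bool (t x \<in> X) - of_bool (h x \<in> X) :: int) = 0"
      using q[OF _ True] X(2) unfolding t_def h_def s_def by (simp cong: sum.cong)
    moreover have "(\<Sum>x\<in>M. of_bool (t x \<in> X) - of_bool (h x \<in> X) :: int) =
        (\<Sum>x\<in>M. of_bool (t x \<in> X \<and> h x \<notin> X) - of_bool (t x \<notin> X \<and> h x \<in> X))"
      by (intro sum.cong) auto
    moreover have "\<dots> = int (card P) - int (card Q)"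
      using finite(1) by (simp add: sum_subtractf P_def Q_def Int_def)
    ultimately have eq: "card P = card Q" by simp
    \<comment> \<open>\<open>F\<close> does not cross \<open>X\<close>, so every edge of the cut
      lies in \<open>M\<close>.\<close>
    have "edge_cut G X \<subseteq> P \<union> Q"
    proof
      fix x assume "x \<in> edge_cut G X"
      then have x: "x \<in> edges G" "card ({a x, b x} \<inter> X) = 1"
        using ends unfolding edge_cut_def by auto
      have "(a x \<in> X) \<noteq> (b x \<in> X)"
        using x(2) verts[OF x(1)] by (cases "a x \<in> X") (auto simp: Int_insert_left split: if_splits)
      with True have "x \<notin> F" by blast
      with x(1) \<open>(a x \<in> X) \<noteq> (b x \<in> X)\<close> show "x \<in> P \<union> Q"
        unfolding part(1) F_def P_def Q_def t_def h_def by auto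
    qed
    then have "card (edge_cut G X) \<le> card P + card Q"
      using finite(1) by (intro order_trans[OF card_mono card_Un_le]) (auto simp: P_def Q_def)
    moreover have "3 \<le> card (edge_cut G X)"
      using con X unfolding k_edge_connected_def by blast
    \<comment> \<open>\<open>3 \<le> 2 * card P\<close> gives two arcs leaving \<open>X\<close>, and
      one of them is not \<open>e\<close>.\<close>
    ultimately have "2 \<le> card P" using eq by simp
    then have "\<not> P \<subseteq> {e}" using card_mono[of "{e}" P] by auto
    then show ?thesis unfolding P_def part(1) by blast
  qed
  have "is_orientation G D"
    unfolding is_orientation_def D_def using th ends by simp
  moreover have "strong_digraph (pre_digraph.del_arc D e)" if "e \<in> M" for e
    using strong[OF that]
    unfolding strong_digraph_def by (simp add: D_def pre_digraph.del_arc_def)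
  ultimately show ?thesis by blast
qed

section \<open>Three orientations from three colours\<close>

theorem theorem4:
  fixes G :: "('v, 'e) ugraph"
  assumes "finite_multigraph G"
    and "k_edge_connected 3 G"
    and "k_edge_colorable 3 G"
  shows "frank_number G \<le> 3"
proof -
  have fin: "finite (vertices G)" "finite (edges G)"
    and E: "\<And>e. e \<in> edges G \<Longrightarrow> ends G e \<subseteq> vertices G \<and> card (ends G e) = 2"
    using assms(1) unfolding finite_multigraph_def by auto
  have "\<forall>e\<in>edges G. \<exists>x y. ends G e = {x, y} \<and> x \<noteq> y"
    using E by (meson card_2_iff)
  then obtain a b where ab: "\<And>e. e \<in> edges G \<Longrightarrow> ends G e = {a e, b e} \<and> a e \<noteq> b e"
    by metis
  have verts: "a e \<in> vertices G \<and> b e \<in> vertices G \<and> a e \<noteq> b e" if "e \<in> edges G" for e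
    using ab[OF that] E[OF that] by auto
  obtain M :: "nat \<Rightarrow> 'e set" where "(\<forall>i<3. is_matching G (M i)) \<and> (\<Union>i<3. M i) = edges G \<and>
      (\<forall>i<3. \<forall>j<3. i \<noteq> j \<longrightarrow> M i \<inter> M j = {})"
    using assms(3) unfolding k_edge_colorable_def by (elim exE)
  then have matching: "\<And>i. i < 3 \<Longrightarrow> is_matching G (M i)"
    and union: "(\<Union>i<3. M i) = edges G"
    and disj: "\<And>i j. i < 3 \<Longrightarrow> j < 3 \<Longrightarrow> i \<noteq> j \<Longrightarrow> M i \<inter> M j = {}"
    by simp_all
  have edges: "edges G = M 0 \<union> M 1 \<union> M 2"
    unfolding union[symmetric] by (auto simp: numeral_3_eq_3 less_Suc_eq numeral_2_eq_2)
  have "\<exists>D. frank_orientations G 3 D"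
  \<comment> \<open>A single vertex without edges is 3-edge-connected, but its colour classes are
    not perfect matchings.\<close>
  proof (cases "edges G = {}")
    case True
    then have "frank_orientations G 3
        (\<lambda>_. \<lparr>pre_digraph.verts = vertices G, arcs = {}, tail = a, head = b\<rparr>)"
      unfolding frank_orientations_def is_orientation_def by simp
    then show ?thesis by blast
  next
    case False
    have perf: "perfect_on (vertices G) a b (M i)" if "i < 3" for i
      unfolding perfect_on_def
    proof
      fix v assume v: "v \<in> vertices G"
      obtain e where e: "e \<in> edges G" using False by blast
      \<comment> \<open>An edge has two distinct ends, so \<open>{v}\<close> is not the whole vertex
        set and its cut has size at least three.\<close>
      have "{v} \<subset> vertices G" using verts[OF e] v
        by (metis empty_subsetI insert_subset psubsetI singletonD)
      then have "3 \<le> card (edge_cut G {v})"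
        using assms(2) unfolding k_edge_connected_def by blast
      \<comment> \<open>\<open>K j\<close> collects the edges of colour \<open>j\<close> at
        \<open>v\<close>: at most one for each of the three colours, yet at least three together, so
        exactly one each.\<close>
      moreover define K where "K j = {e \<in> M j. v \<in> ends G e}" for j
      have K_sub: "K j \<subseteq> edges G" if "j < 3" for j
        using matching[OF that] unfolding K_def is_matching_def by blast
      have K_le: "card (K j) \<le> 1" if "j < 3" for j
      proof -
        have "x = y" if "x \<in> K j" "y \<in> K j" for x y
          using matching[OF \<open>j < 3\<close>] that unfolding K_def is_matching_def by blast
        then show ?thesis
          by (simp add: card_le_Suc0_iff_eq finite_subset[OF K_sub[OF \<open>j < 3\<close>] fin(2)])
      qed
      have "edge_cut G {v} \<subseteq> K 0 \<union> K 1 \<union> K 2"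
        unfolding edge_cut_def edges K_def by (auto simp: Int_insert_right split: if_splits)
      then have "card (edge_cut G {v}) \<le> card (K 0 \<union> K 1 \<union> K 2)"
        using K_sub[of 0] K_sub[of 1] K_sub[of 2] finite_subset[OF _ fin(2)]
        by (intro card_mono) simp_all
      moreover have "\<dots> \<le> card (K 0) + card (K 1) + card (K 2)"
        using card_Un_le[of "K 0 \<union> K 1" "K 2"] card_Un_le[of "K 0" "K 1"] by linarith
      moreover have "i = 0 \<or> i = 1 \<or> i = 2" using that by auto
      ultimately have "card (K i) = 1"
        using K_le[of 0] K_le[of 1] K_le[of 2] by auto
      have sub: "M i \<subseteq> edges G" and "finite (M i)"
        using matching[OF that] fin(2) finite_subset unfolding is_matching_def by blast+
      have "(\<Sum>e\<in>M i. of_bool (a e = v) + of_bool (b e = v) :: int) =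
          (\<Sum>e\<in>M i. of_bool (v \<in> ends G e))"
      proof (rule sum.cong)
        fix e assume "e \<in> M i"
        with sub ab have "ends G e = {a e, b e}" "a e \<noteq> b e" by blast+
        then show "of_bool (a e = v) + of_bool (b e = v) = (of_bool (v \<in> ends G e) :: int)" by auto
      qed simp
      also have "\<dots> = int (card (K i))"
        using \<open>finite (M i)\<close> by (simp add: K_def Int_def)
      finally show "(\<Sum>e\<in>M i. of_bool (a e = v) + of_bool (b e = v) :: int) = 1"
        using \<open>card (K i) = 1\<close> by simp
    qed
    have step: "\<exists>D. is_orientation G D \<and> (\<forall>e\<in>M i. strong_digraph (pre_digraph.del_arc D e))"
      if ijk: "i < 3" "j < 3" "k < 3" "i \<noteq> j" "i \<noteq> k" "j \<noteq> k" "edges G = M i \<union> M j \<union> M k"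
      for i j k
      by (rule orientation_deleting_matching[OF fin ab[THEN conjunct1] verts assms(2) ijk(7)
            disj[OF ijk(1,2,4)] disj[OF ijk(1,3,5)] disj[OF ijk(2,3,6)]
            perf[OF ijk(1)] perf[OF ijk(2)] perf[OF ijk(3)]])
    have "\<exists>D. is_orientation G D \<and> (\<forall>e\<in>M i. strong_digraph (pre_digraph.del_arc D e))"
      if "i < 3" for i
    proof -
      have "i = 0 \<or> i = 1 \<or> i = 2" using that by auto
      then consider "i = 0" | "i = 1" | "i = 2" by blast
      then show ?thesis
      proof cases
        case 1 show ?thesis unfolding 1 by (rule step[of 0 1 2]) (use edges in auto)
      next
        case 2 show ?thesis unfolding 2 by (rule step[of 1 0 2]) (use edges in auto)
      next
        case 3 show ?thesis unfolding 3 by (rule step[of 2 0 1]) (use edges in auto)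
      qed
    qed
    then have "\<forall>i. \<exists>D. i < 3 \<longrightarrow>
        is_orientation G D \<and> (\<forall>e\<in>M i. strong_digraph (pre_digraph.del_arc D e))" by blast
    from choice[OF this] obtain D where D: "\<And>i. i < 3 \<Longrightarrow>
        is_orientation G (D i) \<and> (\<forall>e\<in>M i. strong_digraph (pre_digraph.del_arc (D i) e))" by blast
    \<comment> \<open>Colour classes are numbered from 0 but orientations from 1, hence the
      shift.\<close>
    have "frank_orientations G 3 (\<lambda>i. D (i - 1))"
      unfolding frank_orientations_def
    proof (intro conjI ballI)
      fix i :: nat assume "i \<in> {1..3}"
      then have "i - 1 < 3" by auto
      then show "is_orientation G (D (i - 1))" using D by blast
    next
      fix e assume "e \<in> edges G"
      then have "e \<in> (\<Union>i<3. M i)" by (simp only: union)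
      then obtain i where "i < 3" "e \<in> M i" by blast
      then show "\<exists>i\<in>{1..3}. strong_digraph (pre_digraph.del_arc (D (i - 1)) e)"
        using D by (intro bexI[of _ "Suc i"]) simp_all
    qed
    then show ?thesis by blast
  qed
  then have "frank_number G \<le> enat 3"
    unfolding frank_number_def by (intro Inf_lower) blast
  then show ?thesis by (simp add: numeral_eq_enat)
qed

end
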